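(* Let $r \in \mathbb{N}$ with $r \geq 2$, let $p \in (0,1)$, and let $\phi = \log(p/(1-p))$. Let $N_1$ be the number of samples of an i.i.d. Bernoulli($p$) sequence observed until exactly $r$ successes have occurred, and let $N_2$ be the number of samples of a second i.i.d. Bernoulli($p$) sequence, independent of the first, observed until exactly $r$ failures have occurred. Define $\hat\phi = -H_{N_1-1}+H_{N_2-1}$ and $N = N_1+N_2$. Then the efficiency of $\hat\phi$ satisfies $$\eta(\hat\phi) = \frac{1}{p(1-p)\,\mathrm{Var}[\hat\phi]\,\mathrm{E}[N]} > \frac{1}{\dfrac{r^3-r^2/4-r/4}{(r-1+p)(r-p)(r-1/2)} - \dfrac{r\,p(1-p)}{(r-1/2)^2}\left(1-\dfrac{1}{2r-3}\right)}$$ $$> \frac{r-5/4}{r}\cdot\frac{(4r-1)^2}{(4r-1)^2-7} > \frac{r-5/4}{r}.$$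
   Context: $H_n = 1+1/2+\cdots+1/n$ denotes the $n$-th harmonic number, and $\log$ is the natural logarithm. A Bernoulli($p$) variable takes the value "success" with probability $p$ and "failure" with probability $1-p$. Sample counts include the last success (respectively failure), so $\Pr[N_1=n]=\binom{n-1}{r-1}p^{r}(1-p)^{n-r}$ and $\Pr[N_2=n]=\binom{n-1}{r-1}(1-p)^{r}p^{n-r}$ for $n\ge r$; $N_1$ and $N_2$ are independent. For an unbiased estimator $\hat\theta$ of a differentiable function $\theta$ of $p$, based on a random number $N$ of i.i.d. Bernoulli($p$) observations, the efficiency is defined (as the ratio of Wolfowitz's lower bound for $\mathrm{Var}[\hat\theta]\,\mathrm{E}[N]$ to its actual value) by $$\eta(\hat\theta) = \frac{(\mathrm{d}\theta/\mathrm{d}p)^2\,p(1-p)}{\mathrm{Var}[\hat\theta]\,\mathrm{E}[N]}.$$ Here $\theta=\phi$ and $\hat\theta=\hat\phi$. *)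

theory Defs
  imports "HOL-Probability.Probability"
begin

definition iid_bernoulli :: "'a measure \<Rightarrow> real \<Rightarrow> (nat \<Rightarrow> 'a \<Rightarrow> bool) \<Rightarrow> bool" where
  "iid_bernoulli M p X \<longleftrightarrow>
     prob_space.indep_vars M (\<lambda>_. count_space UNIV) X UNIV \<and>
     (\<forall>i. distr M (count_space UNIV) (X i) = measure_pmf (bernoulli_pmf p))"

definition indep_sequences :: "'a measure \<Rightarrow> (nat \<Rightarrow> 'a \<Rightarrow> bool) \<Rightarrow> (nat \<Rightarrow> 'a \<Rightarrow> bool) \<Rightarrow> bool" where
  "indep_sequences M X Y \<longleftrightarrow>
     prob_space.indep_var M
       (Pi\<^sub>M UNIV (\<lambda>_. count_space UNIV)) (\<lambda>\<omega> i. X i \<omega>)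
       (Pi\<^sub>M UNIV (\<lambda>_. count_space UNIV)) (\<lambda>\<omega> i. Y i \<omega>)"

(* Observations are indexed from 0, so n samples are those with index below n; the r-th
   occurrence is itself counted.  If there are fewer than r occurrences (a null event in
   Bernoulli trials with p in (0,1)), the value is Inf {} = 0. *)
definition samples_until :: "nat \<Rightarrow> (nat \<Rightarrow> 'a \<Rightarrow> bool) \<Rightarrow> 'a \<Rightarrow> nat" where
  "samples_until r E \<omega> = Inf {n. card {i. i < n \<and> E i \<omega>} = r}"

definition log_odds :: "real \<Rightarrow> real" where
  "log_odds p = ln (p / (1 - p))"

(* The parameter enters as a function \<theta> of p; M is the probability space for the given value p,
   est is an unbiased estimator of \<theta> p, and N is the number of observations used.  Var[est] and
   E[N] are Bochner integrals, hence 0 (and the quotient 0) if the integrals do not exist. *)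
definition efficiency ::
    "'a measure \<Rightarrow> (real \<Rightarrow> real) \<Rightarrow> real \<Rightarrow> ('a \<Rightarrow> real) \<Rightarrow> ('a \<Rightarrow> nat) \<Rightarrow> real" where
  "efficiency M \<theta> p est N =
     (deriv \<theta> p)\<^sup>2 * p * (1 - p) /
     (prob_space.variance M est * prob_space.expectation M (\<lambda>\<omega>. real (N \<omega>)))"

end

(*
  Put x = 1 - p and let E_x g be the mean of g(N_1).  Comparing coefficients in the negative binomial
  series gives d/dx E_x g = E_x[N (g(N + 1) - g(N))] / (1 - x).  For g(n) = H_{n-1} the increment is
  1/n, so E_x g has derivative 1 / (1 - x), and the variance V of H_{N_1-1} satisfies V(0) = 0 and
  V'(x) = E_x[1/N] / (1 - x).  Since E_x[1/(N-1)] = (1 - x) / (r - 1) exactly, a Cauchy-Schwarz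
  estimate bounds V'(x) by 1/r + x / (r (r - 1)), hence V(x) <= x/r + x^2 / (2 r (r - 1)).
  As E[N_1 + N_2] = r / (p (1 - p)), the reciprocal of the efficiency is r (V(1 - p) + V(p)), which is at
  most 1 + (p^2 + (1 - p)^2) / (2 (r - 1)); this leaves rational inequalities in r and p (1 - p).
*)
theory Submission
  imports Defs
begin

section \<open>Negative binomial means as power series\<close>

text \<open>Counts the ways to place \<open>m\<close> failures among the \<open>m + r - 1\<close>
  trials that precede the \<open>r\<close>-th success.\<close>

definition nb_coeff :: "nat \<Rightarrow> nat \<Rightarrow> real" where
  "nb_coeff r m = real ((m + r - 1) choose m)"

text \<open>The index \<open>m\<close> counts failures, so the sample count is \<open>m + r\<close>
  and \<open>x\<close> is the failure probability. As a power series this also makes sense for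
  negative \<open>x\<close>, which gives a two-sided derivative at \<open>x = 0\<close>, where the
  variance starts.\<close>

definition nb_mean :: "nat \<Rightarrow> (nat \<Rightarrow> real) \<Rightarrow> real \<Rightarrow> real" where
  "nb_mean r g x = (1 - x) ^ r * (\<Sum>m. nb_coeff r m * g m * x ^ m)"

text \<open>A growth class containing the sample count and the squared harmonic numbers. The bound
  is a rising product rather than a square because multiplying \<open>nb_coeff r\<close> by it gives
  a multiple of \<open>nb_coeff (r + 2)\<close>.\<close>

definition quad_growth :: "nat \<Rightarrow> (nat \<Rightarrow> real) \<Rightarrow> bool" where
  "quad_growth r g \<longleftrightarrow> (\<exists>C. \<forall>m. \<bar>g m\<bar> \<le> C * (real (m + r) * real (m + r + 1)))"

section \<open>Coefficient identities, summability and differentiation\<close>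

lemma nb_coeff_nonneg: "0 \<le> nb_coeff r m"
  by (simp add: nb_coeff_def)

lemma nb_coeff_Suc:
  assumes "r \<ge> 1"
  shows "real (Suc m) * nb_coeff r (Suc m) = real (m + r) * nb_coeff r m"
proof -
  obtain s where r: "r = Suc s" using assms by (cases r) auto
  have "Suc m * (Suc (m + s) choose Suc m) = Suc (m + s) * (m + s choose m)"
    using Suc_times_binomial_eq[of "m + s" m] by (simp add: mult.commute)
  then have "real (Suc m * (Suc (m + s) choose Suc m)) = real (Suc (m + s) * (m + s choose m))"
    by (rule arg_cong)
  then show ?thesis by (simp add: nb_coeff_def r del: binomial_Suc_Suc mult_Suc)
qed

text \<open>Weighting by the sample count raises \<open>r\<close> by one. This absorbs polynomial
  factors here and, read backwards, the factor 1/(N - 1) later.\<close>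

lemma nb_coeff_times: "r \<ge> 1 \<Longrightarrow> real (m + r) * nb_coeff r m = real r * nb_coeff (Suc r) m"
proof -
  assume "r \<ge> 1"
  then obtain s where r: "r = Suc s" by (cases r) auto
  have "Suc (m + s) * (m + s choose m) = Suc s * (Suc (m + s) choose m)"
    using Suc_times_binomial_eq[of "m + s" s]
    by (metis add_diff_cancel_left' add_diff_cancel_right' add_Suc_right binomial_symmetric le_add1 le_add2 mult.commute)
  then have "real (Suc (m + s) * (m + s choose m)) = real (Suc s * (Suc (m + s) choose m))"
    by (rule arg_cong)
  then show ?thesis by (simp add: nb_coeff_def r del: mult_Suc)
qed

lemma pmf_nat_sums_1: "pmf (P :: nat pmf) sums 1"
proof -
  have i: "integrable (count_space UNIV) (pmf P)"
    by (rule integrable_pmf)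
  then have "summable (pmf P)"
    using integrable_count_space_nat_iff summable_norm_cancel by blast
  moreover have "suminf (pmf P) = 1"
    using integral_count_space_nat[OF i] integral_pmf[of UNIV P] by simp
  ultimately show ?thesis by (simp add: sums_iff)
qed

text \<open>The masses of \<open>neg_binomial_pmf\<close> with success probability
  \<open>1 - x\<close> sum to 1; dividing by \<open>(1 - x) ^ r\<close> gives the series.\<close>

lemma nb_coeff_sums:
  assumes "r \<ge> 1" "0 \<le> x" "x < 1"
  shows "(\<lambda>m. nb_coeff r m * x ^ m) sums (1 / (1 - x) ^ r)"
proof -
  have "pmf (neg_binomial_pmf r (1 - x)) = (\<lambda>m. (1 - x) ^ r * (nb_coeff r m * x ^ m))"
    using assms by (intro ext, subst pmf_neg_binomial) (auto simp: nb_coeff_def)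
  then have "(\<lambda>m. (1 - x) ^ r * (nb_coeff r m * x ^ m)) sums 1"
    using pmf_nat_sums_1[of "neg_binomial_pmf r (1 - x)"] by simp
  from sums_divide[OF this, of "(1 - x) ^ r"] show ?thesis
    using assms by simp
qed

lemma summable_nb_coeff:
  assumes "r \<ge> 1" "\<bar>x\<bar> < 1"
  shows "summable (\<lambda>m. nb_coeff r m * x ^ m)"
proof (rule summable_norm_cancel)
  show "summable (\<lambda>m. norm (nb_coeff r m * x ^ m))"
    using nb_coeff_sums[of r "\<bar>x\<bar>"] assms
    by (simp add: abs_mult power_abs nb_coeff_nonneg sums_iff)
qed

lemma summable_nb:
  assumes r: "r \<ge> 1" and g: "quad_growth r g" and x: "\<bar>x\<bar> < 1"
  shows "summable (\<lambda>m. nb_coeff r m * g m * x ^ m)"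
proof -
  obtain C where C: "\<bar>g m\<bar> \<le> C * (real (m + r) * real (m + r + 1))" for m
    using g unfolding quad_growth_def by blast
  \<comment> \<open>Two applications of \<open>nb_coeff_times\<close> turn the dominating series
    into the one for \<open>r + 2\<close>, which converges.\<close>
  have eq: "nb_coeff r m * (real (m + r) * real (m + r + 1)) = real r * (real r + 1) * nb_coeff (Suc (Suc r)) m" for m
  proof -
    have "nb_coeff r m * (real (m + r) * real (m + r + 1))
        = real (m + Suc r) * (real (m + r) * nb_coeff r m)" by simp
    also have "\<dots> = real r * (real (m + Suc r) * nb_coeff (Suc r) m)"
      using nb_coeff_times[OF r, of m] by simp
    also have "\<dots> = real r * (real r + 1) * nb_coeff (Suc (Suc r)) m"
      using nb_coeff_times[of "Suc r" m] by simp
    finally show ?thesis .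
  qed
  have "summable (\<lambda>m. C * (real r * (real r + 1) * (nb_coeff (Suc (Suc r)) m * \<bar>x\<bar> ^ m)))"
    using x by (intro summable_mult summable_nb_coeff) auto
  then show ?thesis
  proof (rule summable_comparison_test[rotated], intro exI allI impI)
    fix m
    have "norm (nb_coeff r m * g m * x ^ m) = nb_coeff r m * \<bar>g m\<bar> * \<bar>x\<bar> ^ m"
      by (simp add: abs_mult power_abs nb_coeff_nonneg)
    also have "\<dots> \<le> nb_coeff r m * (C * (real (m + r) * real (m + r + 1))) * \<bar>x\<bar> ^ m"
      by (intro mult_right_mono mult_left_mono C nb_coeff_nonneg) auto
    also have "\<dots> = C * (nb_coeff r m * (real (m + r) * real (m + r + 1))) * \<bar>x\<bar> ^ m"
      by (simp only: mult_ac)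
    also have "\<dots> = C * (real r * (real r + 1) * (nb_coeff (Suc (Suc r)) m * \<bar>x\<bar> ^ m))"
      unfolding eq by (simp only: mult_ac)
    finally show "norm (nb_coeff r m * g m * x ^ m) \<le> \<dots>" .
  qed
qed

text \<open>Write the mean as (1 - x)^r A(x). Its derivative times 1 - x is (1 - x)^r ((1 - x) A' -
  r A), and the bracket has coefficients (m + 1) a_(m+1) - (m + r) a_m. By
  \<open>nb_coeff_Suc\<close> both terms carry the factor (m + r) \<open>nb_coeff r m\<close>,
  leaving a forward difference of \<open>g\<close>.\<close>

lemma nb_mean_deriv:
  assumes r: "r \<ge> 1" and g: "quad_growth r g" and x: "\<bar>x\<bar> < 1"
  shows "(nb_mean r g has_real_derivative
     nb_mean r (\<lambda>m. real (m + r) * (g (Suc m) - g m)) x / (1 - x)) (at x)"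
proof -
  define a where "a = (\<lambda>m. nb_coeff r m * g m)"
  have sm: "summable (\<lambda>m. a m * z ^ m)" if "norm z < 1" for z
    using summable_nb[OF r g, of z] that by (simp add: a_def)
  define A where "A = (\<lambda>z. \<Sum>m. a m * z ^ m)"
  define A' where "A' = (\<Sum>m. diffs a m * x ^ m)"
  have dA: "(A has_real_derivative A') (at x)"
    unfolding A_def A'_def by (rule termdiffs_strong'[of 1]) (use sm x in auto)
  have "summable (\<lambda>m. diffs a m * x ^ m)"
    by (rule termdiff_converges[of x 1]) (use sm x in auto)
  then have sA': "(\<lambda>m. diffs a m * x ^ m) sums A'"
    by (simp add: A'_def summable_sums)
  have "(\<lambda>m. real (Suc m) * a (Suc m) * x ^ Suc m) sums (x * A')"
    using sums_mult[OF sA', of x] by (simp add: diffs_def mult_ac)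
  \<comment> \<open>The index shift is free because the term at \<open>m = 0\<close>
    vanishes.\<close>
  then have sxA': "(\<lambda>m. real m * a m * x ^ m) sums (x * A')"
    using sums_Suc[of "\<lambda>m. real m * a m * x ^ m" "x * A'"] by simp
  have sA: "(\<lambda>m. a m * x ^ m) sums A x"
    unfolding A_def using sm x by (intro summable_sums) auto
  have "(\<lambda>m. diffs a m * x ^ m - real m * a m * x ^ m - real r * (a m * x ^ m)) sums (A' - x * A' - real r * A x)"
    by (intro sums_diff sA' sxA' sums_mult sA)
  moreover have "diffs a m * x ^ m - real m * a m * x ^ m - real r * (a m * x ^ m)
     = nb_coeff r m * (real (m + r) * (g (Suc m) - g m)) * x ^ m" for m
  proof -
    have "diffs a m = real (m + r) * nb_coeff r m * g (Suc m)"
      using nb_coeff_Suc[OF r, of m] by (simp add: diffs_def a_def)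
    then show ?thesis by (simp add: a_def algebra_simps)
  qed
  ultimately have S: "(\<lambda>m. nb_coeff r m * (real (m + r) * (g (Suc m) - g m)) * x ^ m) sums (A' - x * A' - real r * A x)"
    by simp
  have eq: "nb_mean r (\<lambda>m. real (m + r) * (g (Suc m) - g m)) x = (1 - x) ^ r * (A' - x * A' - real r * A x)"
    using S by (simp add: nb_mean_def sums_iff)
  have "((\<lambda>z. (1 - z) ^ r * A z) has_real_derivative
      (1 - x) ^ r * A' + (- (real r * (1 - x) ^ (r - 1))) * A x) (at x)"
    by (rule derivative_eq_intros dA refl | simp)+
  moreover have "(1 - x) ^ r * A' + (- (real r * (1 - x) ^ (r - 1))) * A x
     = nb_mean r (\<lambda>m. real (m + r) * (g (Suc m) - g m)) x / (1 - x)"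
  proof -
    obtain s where "r = Suc s" using r by (cases r) auto
    then show ?thesis unfolding eq using x by (simp add: field_simps)
  qed
  moreover have "(\<lambda>z. (1 - z) ^ r * A z) = nb_mean r g"
    by (simp add: nb_mean_def A_def a_def fun_eq_iff)
  ultimately show ?thesis by simp
qed

section \<open>Rules and exact values for negative binomial means\<close>

lemma nb_mean_const:
  assumes "r \<ge> 1" "0 \<le> x" "x < 1"
  shows "nb_mean r (\<lambda>_. c) x = c"
  using sums_mult[OF nb_coeff_sums[OF assms], of c] assms
  by (simp add: nb_mean_def sums_iff mult_ac)

lemma nb_mean_mult: "r \<ge> 1 \<Longrightarrow> \<bar>x\<bar> < 1 \<Longrightarrow> quad_growth r f \<Longrightarrow> 
   nb_mean r (\<lambda>m. c * f m) x = c * nb_mean r f x"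
  using suminf_mult[OF summable_nb[of r f x], of c] by (simp add: nb_mean_def mult_ac)

lemma nb_mean_add:
  assumes "r \<ge> 1" "quad_growth r f" "quad_growth r g" "\<bar>x\<bar> < 1"
  shows "nb_mean r (\<lambda>m. f m + g m) x = nb_mean r f x + nb_mean r g x"
proof -
  have "(\<Sum>m. nb_coeff r m * (f m + g m) * x ^ m)
      = (\<Sum>m. nb_coeff r m * f m * x ^ m + nb_coeff r m * g m * x ^ m)"
    by (simp add: algebra_simps)
  also have "\<dots> = (\<Sum>m. nb_coeff r m * f m * x ^ m) + (\<Sum>m. nb_coeff r m * g m * x ^ m)"
    using assms by (intro suminf_add[symmetric] summable_nb)
  finally show ?thesis by (simp add: nb_mean_def distrib_left)
qed

lemma nb_mean_mono:
  assumes "r \<ge> 1" "quad_growth r f" "quad_growth r g" "0 \<le> x" "x < 1" "\<And>m. f m \<le> g m"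
  shows "nb_mean r f x \<le> nb_mean r g x"
  unfolding nb_mean_def using assms
  by (intro mult_left_mono suminf_le summable_nb mult_right_mono nb_coeff_nonneg) auto

lemma nb_mean_at_0: "nb_mean r g 0 = g 0"
  by (simp add: nb_mean_def nb_coeff_def)

text \<open>Division by m + r - 1 lowers \<open>r\<close> by one, so the series is again an explicit
  one; \<open>r \<ge> 2\<close> keeps the lowered parameter positive.\<close>

lemma nb_mean_inverse_pred:
  assumes r: "r \<ge> 2" and x: "0 \<le> x" "x < 1"
  shows "nb_mean r (\<lambda>m. 1 / (real (m + r) - 1)) x = (1 - x) / (real r - 1)"
proof -
  obtain s where s: "r = Suc s" "s \<ge> 1" using r by (cases r) auto
  have "nb_coeff r m * (1 / (real (m + r) - 1)) = nb_coeff s m / real s" for m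
    using nb_coeff_times[of s m] s by (simp add: field_simps)
  then have "(\<Sum>m. nb_coeff r m * (1 / (real (m + r) - 1)) * x ^ m) = (\<Sum>m. nb_coeff s m * x ^ m / real s)"
    by simp
  also have "\<dots> = 1 / (1 - x) ^ s / real s"
    using sums_divide[OF nb_coeff_sums[OF s(2) x], of "real s"] by (simp add: sums_iff)
  finally show ?thesis using x s(1) by (simp add: nb_mean_def)
qed

lemma nb_mean_count:
  assumes r: "r \<ge> 1" and x: "0 \<le> x" "x < 1"
  shows "nb_mean r (\<lambda>m. real (m + r)) x = real r / (1 - x)"
proof -
  have "(\<Sum>m. nb_coeff r m * real (m + r) * x ^ m) = (\<Sum>m. real r * (nb_coeff (Suc r) m * x ^ m))"
    using nb_coeff_times[OF r] by (simp add: mult_ac)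
  also have "\<dots> = real r * (1 / (1 - x) ^ Suc r)"
    using sums_mult[OF nb_coeff_sums[of "Suc r" x], of "real r"] x by (simp add: sums_iff)
  finally show ?thesis using x by (simp add: nb_mean_def)
qed

section \<open>Verifying the growth condition\<close>

lemma quad_growthI:
  assumes "r \<ge> 1" "\<And>m. \<bar>g m\<bar> \<le> real (m + r) ^ 2"
  shows "quad_growth r g"
  unfolding quad_growth_def
proof (intro exI[of _ 1] allI)
  fix m
  have "real (m + r) ^ 2 \<le> real (m + r) * real (m + r + 1)"
    by (simp add: power2_eq_square algebra_simps)
  then show "\<bar>g m\<bar> \<le> 1 * (real (m + r) * real (m + r + 1))"
    using assms(2)[of m] by linarith
qed

lemma quad_growth_bounded_by_index:
  assumes "r \<ge> 1" "\<And>m. \<bar>g m\<bar> \<le> real (m + r)"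
  shows "quad_growth r g"
proof (rule quad_growthI[OF assms(1)])
  fix m
  have "real (m + r) \<le> real (m + r) ^ 2" using assms(1) by (simp add: power2_eq_square)
  then show "\<bar>g m\<bar> \<le> real (m + r) ^ 2" using assms(2)[of m] by linarith
qed

lemma quad_growth_add: "quad_growth r f \<Longrightarrow> quad_growth r g \<Longrightarrow> quad_growth r (\<lambda>m. f m + g m)"
proof -
  assume "quad_growth r f" "quad_growth r g"
  then obtain C D where "\<And>m. \<bar>f m\<bar> \<le> C * (real (m + r) * real (m + r + 1))"
    "\<And>m. \<bar>g m\<bar> \<le> D * (real (m + r) * real (m + r + 1))"
    unfolding quad_growth_def by blast
  then have "\<bar>f m + g m\<bar> \<le> (C + D) * (real (m + r) * real (m + r + 1))" for m
    using abs_triangle_ineq[of "f m" "g m"] by (smt (verit) distrib_right)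
  then show ?thesis unfolding quad_growth_def by blast
qed

lemma quad_growth_mult: "quad_growth r f \<Longrightarrow> quad_growth r (\<lambda>m. c * f m)"
proof -
  assume "quad_growth r f"
  then obtain C where "\<And>m. \<bar>f m\<bar> \<le> C * (real (m + r) * real (m + r + 1))"
    unfolding quad_growth_def by blast
  then have "\<bar>c * f m\<bar> \<le> (\<bar>c\<bar> * C) * (real (m + r) * real (m + r + 1))" for m
    by (simp add: abs_mult mult_left_mono mult.assoc)
  then show ?thesis unfolding quad_growth_def by blast
qed

section \<open>Variance of a harmonic number with negative binomial index\<close>

lemma harm_le_self: "harm n \<le> (real n)"
proof (induction n)
  case (Suc n)
  have "inverse (real (Suc n)) \<le> 1" by (simp add: divide_simps)
  then show ?case using Suc by (simp add: harm_Suc)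
qed (simp add: harm_def)

definition nb_harm_var :: "nat \<Rightarrow> real \<Rightarrow> real" where
  "nb_harm_var r x = nb_mean r (\<lambda>m. (harm (m + r - 1))\<^sup>2) x - (nb_mean r (\<lambda>m. harm (m + r - 1)) x)\<^sup>2"

lemma nb_harm_var_0: "nb_harm_var r 0 = 0"
  by (simp add: nb_harm_var_def nb_mean_at_0)

context
  fixes r :: nat
  assumes r: "r \<ge> 2"
begin

lemma quad_growth_harm: "quad_growth r (\<lambda>m. harm (m + r - 1))"
proof (rule quad_growth_bounded_by_index)
  fix m
  have "harm (m + r - 1) \<le> real (m + r)"
    using harm_le_self[of "m + r - 1"] by linarith
  then show "\<bar>harm (m + r - 1) :: real\<bar> \<le> real (m + r)"
    using harm_nonneg[of "m + r - 1", where ?'a = real] by simp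
qed (use r in simp)

lemma quad_growth_harm_sq: "quad_growth r (\<lambda>m. (harm (m + r - 1))\<^sup>2)"
proof (rule quad_growthI)
  fix m
  have "harm (m + r - 1) \<le> real (m + r)"
    using harm_le_self[of "m + r - 1"] by linarith
  then show "\<bar>(harm (m + r - 1))\<^sup>2 :: real\<bar> \<le> real (m + r) ^ 2"
    using harm_nonneg[of "m + r - 1", where ?'a = real] by (simp add: power_mono)
qed (use r in simp)

lemma quad_growth_const: "quad_growth r (\<lambda>_. c)"
proof -
  have "quad_growth r (\<lambda>_. 1)"
    by (rule quad_growth_bounded_by_index) (use r in auto)
  from quad_growth_mult[OF this, of c] show ?thesis by simp
qed

lemma quad_growth_inverse: "quad_growth r (\<lambda>m. 1 / real (m + r))"
proof (rule quad_growth_bounded_by_index)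
  fix m
  have n: "1 \<le> real (m + r)" using r by simp
  then have "1 / real (m + r) \<le> 1" by simp
  then have "1 / real (m + r) \<le> real (m + r)" using n by (rule order_trans)
  then show "\<bar>1 / real (m + r)\<bar> \<le> real (m + r)" by simp
qed (use r in simp)

lemma quad_growth_inverse_pred: "quad_growth r (\<lambda>m. 1 / (real (m + r) - 1))"
proof (rule quad_growth_bounded_by_index)
  fix m
  have n: "1 \<le> real (m + r) - 1" using r by simp
  then have "1 / (real (m + r) - 1) \<le> 1" by (subst pos_divide_le_eq) auto
  also have "1 \<le> real (m + r)" using n by linarith
  finally have "1 / (real (m + r) - 1) \<le> real (m + r)" .
  moreover have "0 \<le> 1 / (real (m + r) - 1)" using n by (intro divide_nonneg_nonneg) linarith+
  ultimately show "\<bar>1 / (real (m + r) - 1)\<bar> \<le> real (m + r)" by linarith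
qed (use r in simp)

text \<open>With H the harmonic number and N the sample count, N times the increment of H is 1, and
  N times the increment of H^2 is 2 H + 1/N. The term 2 E[H] cancels against the derivative of the
  squared mean, so only E[1/N] remains.\<close>

lemma nb_harm_var_deriv:
  assumes x: "0 \<le> x" "x < 1"
  shows "(nb_harm_var r has_real_derivative nb_mean r (\<lambda>m. 1 / real (m + r)) x / (1 - x)) (at x)"
proof -
  have r1: "r \<ge> 1" and ax: "\<bar>x\<bar> < 1" using r x by auto
  define H where "H = (\<lambda>m. harm (m + r - 1) :: real)"
  have step: "H (Suc m) = H m + 1 / real (m + r)" for m
  proof -
    obtain s where "r = Suc s" using r by (cases r) auto
    then show ?thesis by (simp add: H_def harm_Suc divide_inverse add_ac)
  qed
  have nz: "real (m + r) \<noteq> 0" for m using r by simp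
  have "(\<lambda>m. real (m + r) * (H (Suc m) - H m)) = (\<lambda>_. 1)"
    unfolding step using nz by simp
  then have d1: "(nb_mean r H has_real_derivative 1 / (1 - x)) (at x)"
    using nb_mean_deriv[OF r1 quad_growth_harm ax] nb_mean_const[OF r1 x, of 1]
    by (simp add: H_def)
  have "real (m + r) * ((H (Suc m))\<^sup>2 - (H m)\<^sup>2) = 2 * H m + 1 / real (m + r)" for m
  proof -
    have "(H (Suc m))\<^sup>2 - (H m)\<^sup>2 = (1 / real (m + r)) * (2 * H m + 1 / real (m + r))"
      unfolding step power2_eq_square by (simp add: algebra_simps)
    then show ?thesis using nz[of m] by simp
  qed
  then have "(\<lambda>m. real (m + r) * ((H (Suc m))\<^sup>2 - (H m)\<^sup>2)) = (\<lambda>m. 2 * H m + 1 / real (m + r))"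
    by auto
  then have d2: "(nb_mean r (\<lambda>m. (H m)\<^sup>2) has_real_derivative
      (2 * nb_mean r H x + nb_mean r (\<lambda>m. 1 / real (m + r)) x) / (1 - x)) (at x)"
    using nb_mean_deriv[OF r1 quad_growth_harm_sq ax]
      nb_mean_add[OF r1 quad_growth_mult[OF quad_growth_harm] quad_growth_inverse ax, of 2]
      nb_mean_mult[OF r1 ax quad_growth_harm, of 2]
    by (simp add: H_def)
  have "nb_harm_var r = (\<lambda>z. nb_mean r (\<lambda>m. (H m)\<^sup>2) z - (nb_mean r H z)\<^sup>2)"
    by (simp add: nb_harm_var_def H_def fun_eq_iff)
  moreover have "((\<lambda>z. nb_mean r (\<lambda>m. (H m)\<^sup>2) z - (nb_mean r H z)\<^sup>2) has_real_derivative
     nb_mean r (\<lambda>m. 1 / real (m + r)) x / (1 - x)) (at x)"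
    by (rule derivative_eq_intros d1 d2 refl)+ (simp add: add_divide_distrib)
  ultimately show ?thesis by simp
qed

lemma nb_mean_inverse_pos:
  assumes x: "0 \<le> x" "x < 1"
  shows "nb_mean r (\<lambda>m. 1 / real (m + r)) x > 0"
proof -
  have "(\<Sum>m. nb_coeff r m * (1 / real (m + r)) * x ^ m) > 0"
  proof (rule suminf_pos2[of _ 0])
    show "summable (\<lambda>m. nb_coeff r m * (1 / real (m + r)) * x ^ m)"
      using x r by (intro summable_nb quad_growth_inverse) auto
  qed (use x r in \<open>auto simp: nb_coeff_def\<close>)
  then show ?thesis using x by (simp add: nb_mean_def)
qed

text \<open>E[1/N] is not elementary, but 1/N is bounded pointwise by a combination of 1/(N - 1) and
  a constant, whose means are exact. Divided by \<open>1 - x\<close>, the bound is linear in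
  \<open>x\<close> and easy to integrate.\<close>

lemma nb_mean_inverse_le:
  assumes x: "0 \<le> x" "x < 1"
  shows "nb_mean r (\<lambda>m. 1 / real (m + r)) x \<le> (1 - x) * (1 / real r + x / (real r * (real r - 1)))"
proof -
  have r1: "r \<ge> 1" and ax: "\<bar>x\<bar> < 1" using r x by auto
  define a where "a = (1 - x) / real r"
  \<comment> \<open>Titu's form of the Cauchy--Schwarz inequality, split as \<open>1 = (1 - a) + a\<close>
    with \<open>a = 1 / E N\<close>\<close>
  have titu: "1 / real (m + r) \<le> (1 - a)\<^sup>2 * (1 / (real (m + r) - 1)) + a\<^sup>2" for m
  proof -
    define n where "n = real (m + r)"
    have n: "n > 1" using r by (simp add: n_def)
    have "1 / n = (n - 1) / (n * (n - 1))" using n by simp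
    also have "\<dots> \<le> ((1 - a)\<^sup>2 * n + a\<^sup>2 * (n * (n - 1))) / (n * (n - 1))"
    proof (rule divide_right_mono)
      \<comment> \<open>After clearing \<open>n * (n - 1)\<close> the defect is a perfect square,
        with equality at \<open>n = 1 / a\<close>.\<close>
      have "(1 - a)\<^sup>2 * n + a\<^sup>2 * (n * (n - 1)) - (n - 1) = (1 - a * n)\<^sup>2"
        by (simp add: power2_eq_square algebra_simps)
      then show "n - 1 \<le> (1 - a)\<^sup>2 * n + a\<^sup>2 * (n * (n - 1))"
        using zero_le_power2[of "1 - a * n"] by linarith
    qed (use n in simp)
    also have "\<dots> = (1 - a)\<^sup>2 * (1 / (n - 1)) + a\<^sup>2"
      using n by (simp add: add_divide_distrib)
    finally show ?thesis by (simp add: n_def)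
  qed
  have "nb_mean r (\<lambda>m. 1 / real (m + r)) x
      \<le> nb_mean r (\<lambda>m. (1 - a)\<^sup>2 * (1 / (real (m + r) - 1)) + a\<^sup>2) x"
    by (rule nb_mean_mono[OF r1 quad_growth_inverse
          quad_growth_add[OF quad_growth_mult[OF quad_growth_inverse_pred] quad_growth_const] x titu])
  also have "\<dots> = (1 - a)\<^sup>2 * ((1 - x) / (real r - 1)) + a\<^sup>2"
    by (simp only: nb_mean_add[OF r1 quad_growth_mult[OF quad_growth_inverse_pred] quad_growth_const ax]
      nb_mean_mult[OF r1 ax quad_growth_inverse_pred] nb_mean_inverse_pred[OF r x]
      nb_mean_const[OF r1 x])
  also have "\<dots> \<le> (1 - x) * (1 / real r + x / (real r * (real r - 1)))"
  proof -
    define R where "R = real r"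
    have R: "R \<ge> 2" using r by (simp add: R_def)
    have aR: "a * R = 1 - x" using R by (simp add: a_def R_def)
    \<comment> \<open>Multiplied by \<open>R - 1\<close>, the target becomes
      \<open>(1 - x) * (1 - a)\<close>, and the slack is exactly
      \<open>a\<^sup>2 * x\<close>.\<close>
    have "(1 - x) * (1 - a) - ((1 - a)\<^sup>2 * (1 - x) + a\<^sup>2 * (R - 1)) = a * (1 - a) * (1 - x) - a * (a * R) + a\<^sup>2"
      by (simp add: power2_eq_square algebra_simps)
    also have "\<dots> = a\<^sup>2 * x"
      unfolding aR by (simp add: power2_eq_square algebra_simps)
    also have "\<dots> \<ge> 0" using x by simp
    finally have "(1 - a)\<^sup>2 * (1 - x) + a\<^sup>2 * (R - 1) \<le> (1 - x) * (1 - a)" by simp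
    then have "((1 - a)\<^sup>2 * (1 - x) + a\<^sup>2 * (R - 1)) / (R - 1) \<le> (1 - x) * (1 - a) / (R - 1)"
      using R by (intro divide_right_mono) auto
    moreover have "((1 - a)\<^sup>2 * (1 - x) + a\<^sup>2 * (R - 1)) / (R - 1) = (1 - a)\<^sup>2 * ((1 - x) / (R - 1)) + a\<^sup>2"
      using R by (simp add: add_divide_distrib)
    moreover have "(1 - a) / (R - 1) = 1 / R + x / (R * (R - 1))"
      using R by (simp add: a_def flip: R_def) (simp add: divide_simps)
    moreover have "(1 - x) * (1 - a) / (R - 1) = (1 - x) * ((1 - a) / (R - 1))" by simp
    ultimately have "(1 - a)\<^sup>2 * ((1 - x) / (R - 1)) + a\<^sup>2 \<le> (1 - x) * (1 / R + x / (R * (R - 1)))"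
      by (simp only:)
    then show ?thesis by (simp only: R_def)
  qed
  finally show ?thesis .
qed

text \<open>The variance starts at 0 and has positive derivative E[1/N] / (1 - x). Strict positivity
  is what later permits taking reciprocals.\<close>

lemma nb_harm_var_pos:
  assumes "0 < x" "x < 1"
  shows "nb_harm_var r x > 0"
proof -
  have "nb_harm_var r 0 < nb_harm_var r x"
  proof (rule DERIV_pos_imp_increasing[OF assms(1)])
    fix z assume "0 \<le> z" "z \<le> x"
    then show "\<exists>y. (nb_harm_var r has_real_derivative y) (at z) \<and> y > 0"
      using nb_harm_var_deriv[of z] nb_mean_inverse_pos[of z] assms by auto
  qed
  then show ?thesis by (simp add: nb_harm_var_0)
qed

lemma nb_harm_var_le:
  assumes "0 < x" "x < 1"
  shows "nb_harm_var r x \<le> x / real r + x\<^sup>2 / (2 * real r * (real r - 1))"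
proof -
  define b c where "b = 1 / real r" and "c = 1 / (2 * real r * (real r - 1))"
  \<comment> \<open>The subtracted quadratic is the antiderivative, vanishing at 0, of the bound on
    the derivative of the variance; hence \<open>G\<close> decreases from 0.\<close>
  define G where "G = (\<lambda>z. nb_harm_var r z - (b * z + c * z\<^sup>2))"
  have "G x \<le> G 0"
  proof (rule DERIV_nonpos_imp_nonincreasing[of 0 x G])
    fix z assume z: "0 \<le> z" "z \<le> x"
    then have z1: "z < 1" using assms by simp
    have "(G has_real_derivative nb_mean r (\<lambda>m. 1 / real (m + r)) z / (1 - z)
        - (b + c * (2 * z))) (at z)"
      unfolding G_def
      by (rule derivative_eq_intros nb_harm_var_deriv[OF z(1) z1] refl | simp)+
    moreover have "b + c * (2 * z) = 1 / real r + z / (real r * (real r - 1))"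
      by (simp add: b_def c_def)
    moreover have "nb_mean r (\<lambda>m. 1 / real (m + r)) z / (1 - z) \<le> 1 / real r + z / (real r * (real r - 1))"
      using nb_mean_inverse_le[OF z(1) z1] z1 by (simp add: pos_divide_le_eq mult.commute)
    ultimately show "\<exists>y. (G has_real_derivative y) (at z) \<and> y \<le> 0"
      by (intro exI conjI) auto
  qed (use assms in simp)
  then show ?thesis by (simp add: G_def nb_harm_var_0 b_def c_def)
qed

end

section \<open>The distribution of the number of samples\<close>

lemma samples_until_eqI:
  assumes "card {i. i < m \<and> E i \<omega>} = s" "E m \<omega>"
  shows "samples_until (Suc s) E \<omega> = Suc m"
proof -
  define c where "c n = card {i. i < n \<and> E i \<omega>}" for n
  have "{i. i < Suc m \<and> E i \<omega>} = insert m {i. i < m \<and> E i \<omega>}"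
    using assms(2) by (auto simp: less_Suc_eq)
  then have c_Suc: "c (Suc m) = Suc s"
    using assms(1) by (simp add: c_def)
  \<comment> \<open>The count is monotone, so it cannot reach \<open>Suc s\<close> with
    \<open>m\<close> or fewer samples. Trials are indexed from 0, so a success at index
    \<open>m\<close> is sample number \<open>Suc m\<close>.\<close>
  have c_le: "c k \<le> s" if "k \<le> m" for k
    unfolding c_def assms(1)[symmetric] using that by (intro card_mono) auto
  have "Inf {n. c n = Suc s} = Suc m"
  proof (rule cInf_eq_minimum)
    show "Suc m \<in> {n. c n = Suc s}" using c_Suc by simp
    fix k assume "k \<in> {n. c n = Suc s}"
    then show "Suc m \<le> k" using c_le[of k] by (cases "k \<le> m") auto
  qed
  then show ?thesis by (simp add: samples_until_def c_def)
qed

lemma measurable_samples_until: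
  assumes [measurable]: "\<And>i. E i \<in> measurable M (count_space UNIV)"
  shows "samples_until r E \<in> measurable M (count_space UNIV)"
proof -
  have [measurable]: "(\<lambda>\<omega>. card {i. i < n \<and> E i \<omega>}) \<in> measurable M (count_space UNIV)" for n
    by (rule measurable_card) simp
  \<comment> \<open>As a \<open>LEAST\<close> over countably many measurable conditions the count is
    measurable everywhere, including on the null event where \<open>r\<close> occurrences are never
    reached.\<close>
  have "samples_until r E = (\<lambda>\<omega>. LEAST n. card {i. i < n \<and> E i \<omega>} = r)"
    by (simp add: fun_eq_iff samples_until_def Inf_nat_def)
  then show ?thesis by simp
qed

context prob_space
begin

lemma prob_bernoulli_pattern:
  assumes X: "iid_bernoulli M p X" and p: "0 \<le> p" "p \<le> 1" and S: "S \<subseteq> {..m}"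
  shows "prob {\<omega>\<in>space M. \<forall>i\<le>m. X i \<omega> \<longleftrightarrow> i \<in> S} = p ^ card S * (1 - p) ^ (Suc m - card S)"
proof -
  have ind: "indep_vars (\<lambda>_. count_space UNIV) X UNIV"
    and d: "\<And>i. distr M (count_space UNIV) (X i) = measure_pmf (bernoulli_pmf p)"
    using X by (auto simp: iid_bernoulli_def)
  have rv: "X i \<in> measurable M (count_space UNIV)" for i
    using ind by (auto simp: indep_vars_def)
  have one: "prob (X i -` {b} \<inter> space M) = (if b then p else 1 - p)" for i b
  proof -
    have "prob (X i -` {b} \<inter> space M) = measure (distr M (count_space UNIV) (X i)) {b}"
      using rv by (simp add: measure_distr)
    also have "\<dots> = pmf (bernoulli_pmf p) b" by (simp add: d pmf.rep_eq)
    finally show ?thesis using p by (cases b) auto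
  qed
  have "{\<omega>\<in>space M. \<forall>i\<le>m. X i \<omega> \<longleftrightarrow> i \<in> S} = (\<Inter>i\<in>{..m}. X i -` {i \<in> S} \<inter> space M)"
    by auto
  then have "prob {\<omega>\<in>space M. \<forall>i\<le>m. X i \<omega> \<longleftrightarrow> i \<in> S} = (\<Prod>i\<le>m. prob (X i -` {i \<in> S} \<inter> space M))"
    using indep_varsD[OF ind, of "{..m}" "\<lambda>i. {i \<in> S}"] by simp
  also have "\<dots> = (\<Prod>i\<le>m. if i \<in> S then p else 1 - p)" by (simp only: one)
  also have "\<dots> = p ^ card ({..m} \<inter> S) * (1 - p) ^ card ({..m} \<inter> - S)"
    by (subst prod.If_cases) auto
  also have "{..m} \<inter> S = S" using S by auto
  also have "{..m} \<inter> - S = {..m} - S" by auto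
  also have "card ({..m} - S) = Suc m - card S"
    using S by (subst card_Diff_subset) (auto intro: finite_subset)
  finally show ?thesis .
qed

text \<open>The event splits according to which \<open>s\<close> of the first \<open>m\<close>
  trials succeed. The patterns are disjoint and equally likely, and there are
  \<open>m choose s\<close> of them.\<close>

lemma prob_last_success:
  fixes k s :: nat
  defines "m \<equiv> k + s"
  assumes X: "iid_bernoulli M p X" and p: "0 < p" "p < 1"
  shows "prob {\<omega>\<in>space M. card {i. i < m \<and> X i \<omega>} = s \<and> X m \<omega>} = pmf (neg_binomial_pmf (Suc s) p) k"
proof -
  have rv[measurable]: "X i \<in> measurable M (count_space UNIV)" for i
    using X by (auto simp: iid_bernoulli_def indep_vars_def)
  \<comment> \<open>\<open>T\<close> holds the successes before trial \<open>m\<close>; inserting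
    \<open>m\<close> records the success at which sampling stops.\<close>
  define A where "A T = {\<omega>\<in>space M. \<forall>i\<le>m. X i \<omega> \<longleftrightarrow> i \<in> insert m T}" for T
  define F where "F = {T. T \<subseteq> {..<m} \<and> card T = s}"
  have fin: "finite F" unfolding F_def by simp
  have cF: "card F = (m choose s)"
    unfolding F_def by (subst n_subsets) auto
  have "{\<omega>\<in>space M. card {i. i < m \<and> X i \<omega>} = s \<and> X m \<omega>} = (\<Union>T\<in>F. A T)"
  proof (intro equalityI subsetI)
    fix \<omega> assume "\<omega> \<in> {\<omega>\<in>space M. card {i. i < m \<and> X i \<omega>} = s \<and> X m \<omega>}"
    then have "{i. i < m \<and> X i \<omega>} \<in> F" "\<omega> \<in> A {i. i < m \<and> X i \<omega>}"
      by (auto simp: F_def A_def)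
    then show "\<omega> \<in> (\<Union>T\<in>F. A T)" by blast
  next
    fix \<omega> assume "\<omega> \<in> (\<Union>T\<in>F. A T)"
    then obtain T where T: "T \<subseteq> {..<m}" "card T = s" "\<omega> \<in> A T" by (auto simp: F_def)
    then have "{i. i < m \<and> X i \<omega>} = T" by (auto simp: A_def)
    then show "\<omega> \<in> {\<omega>\<in>space M. card {i. i < m \<and> X i \<omega>} = s \<and> X m \<omega>}"
      using T by (auto simp: A_def)
  qed
  then have "prob {\<omega>\<in>space M. card {i. i < m \<and> X i \<omega>} = s \<and> X m \<omega>} = prob (\<Union>T\<in>F. A T)" by simp
  also have "\<dots> = (\<Sum>T\<in>F. prob (A T))"
  proof (rule finite_measure_finite_Union[OF fin])
    show "A ` F \<subseteq> sets M" unfolding A_def by auto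
    show "disjoint_family_on A F"
    proof (unfold disjoint_family_on_def, intro ballI impI)
      fix T U assume TU: "T \<in> F" "U \<in> F" "T \<noteq> U"
      have "T = U" if "\<omega> \<in> A T" "\<omega> \<in> A U" for \<omega>
      proof -
        have "i \<in> T \<longleftrightarrow> i \<in> U" for i
        proof (cases "i < m")
          case True
          then have "i \<le> m" "i \<noteq> m" by auto
          then show ?thesis using that unfolding A_def by auto
        next
          case False
          then show ?thesis using TU by (auto simp: F_def)
        qed
        then show ?thesis by auto
      qed
      then show "A T \<inter> A U = {}" using TU by auto
    qed
  qed
  also have "\<dots> = (\<Sum>T\<in>F. p ^ Suc s * (1 - p) ^ k)"
  proof (rule sum.cong[OF refl])
    fix T assume T: "T \<in> F"
    then have "finite T" "m \<notin> T" "card T = s" "T \<subseteq> {..<m}"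
      by (auto simp: F_def intro: finite_subset)
    then have "card (insert m T) = Suc s" "insert m T \<subseteq> {..m}" by auto
    then show "prob (A T) = p ^ Suc s * (1 - p) ^ k"
      unfolding A_def using p
      by (subst prob_bernoulli_pattern[OF X]) (auto simp: m_def)
  qed
  also have "\<dots> = real (m choose s) * p ^ Suc s * (1 - p) ^ k" by (simp add: cF)
  also have "m choose s = (k + Suc s - 1) choose k"
    using binomial_symmetric[of s m] by (simp add: m_def)
  finally show ?thesis using p by (simp add: pmf_neg_binomial)
qed

text \<open>On the null event with fewer than \<open>r\<close> successes \<^term>\<open>samples_until\<close> is
  \<^term>\<open>Inf {} :: nat\<close>, an unspecified number which may well be \<open>\<ge> r\<close>.  So only the inclusion
  \<open>B k \<subseteq> {samples_until r X = k + r}\<close> holds outright, and equality holds almost surely because the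
  \<open>B k\<close> already have total mass 1.\<close>

lemma distr_samples_until:
  assumes X: "iid_bernoulli M p X" and p: "0 < p" "p < 1" and r: "r \<ge> 1"
  shows "distr M (count_space UNIV) (samples_until r X) = measure_pmf (map_pmf (\<lambda>k. k + r) (neg_binomial_pmf r p))"
proof -
  have [measurable]: "X i \<in> measurable M (count_space UNIV)" for i
    using X by (auto simp: iid_bernoulli_def indep_vars_def)
  have N[measurable]: "samples_until r X \<in> measurable M (count_space UNIV)"
    by (rule measurable_samples_until) simp
  obtain s where s: "r = Suc s" using r by (cases r) auto
  define B where "B k = {\<omega>\<in>space M. card {i. i < k + s \<and> X i \<omega>} = s \<and> X (k + s) \<omega>}" for k
  have [measurable]: "(\<lambda>\<omega>. card {i. i < n \<and> X i \<omega>}) \<in> measurable M (count_space UNIV)" for n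
    by (rule measurable_card) simp
  have [measurable]: "B k \<in> sets M" for k unfolding B_def by simp
  have pB: "prob (B k) = pmf (neg_binomial_pmf r p) k" for k
    unfolding B_def s by (rule prob_last_success[OF X p])
  have NB: "samples_until r X \<omega> = k + r" if "\<omega> \<in> B k" for k \<omega>
    using that samples_until_eqI[of "k + s" X \<omega> s] by (simp add: B_def s)
  \<comment> \<open>On \<open>B k\<close> the sample count is \<open>k + r\<close>, so it determines
    \<open>k\<close>.\<close>
  have "disjoint_family B"
    unfolding disjoint_family_on_def using NB by (metis Int_emptyI add_right_cancel)
  then have "(\<lambda>k. prob (B k)) sums prob (\<Union>k. B k)"
    by (intro finite_measure_UNION) auto
  then have "(\<lambda>k. pmf (neg_binomial_pmf r p) k) sums prob (\<Union>k. B k)" by (simp only: pB)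
  then have "prob (\<Union>k. B k) = 1"
    using pmf_nat_sums_1[of "neg_binomial_pmf r p"] sums_unique2 by blast
  then have AE: "AE \<omega> in M. \<omega> \<in> (\<Union>k. B k)" by (rule AE_prob_1)
  show ?thesis
  proof (rule measure_eqI_countable_AE[where \<Omega> = "{r..}"])
    show "AE x in distr M (count_space UNIV) (samples_until r X). x \<in> {r..}"
      by (subst AE_distr_iff[OF N]) (use AE in \<open>auto simp: NB elim!: eventually_mono\<close>)
    show "AE x in measure_pmf (map_pmf (\<lambda>k. k + r) (neg_binomial_pmf r p)). x \<in> {r..}"
      by (auto simp: AE_measure_pmf_iff)
    fix n assume "n \<in> {r..}"
    then obtain k where k: "n = k + r" by (metis atLeast_iff le_iff_add add.commute)
    have "emeasure (distr M (count_space UNIV) (samples_until r X)) {n} = emeasure M (samples_until r X -` {n} \<inter> space M)"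
      by (subst emeasure_distr) auto
    also have "\<dots> = emeasure M (B k)"
    proof (rule emeasure_eq_AE)
      show "AE \<omega> in M. \<omega> \<in> samples_until r X -` {n} \<inter> space M \<longleftrightarrow> \<omega> \<in> B k"
        using AE
      proof eventually_elim
        case (elim \<omega>)
        then obtain j where j: "\<omega> \<in> B j" by auto
        then have "\<omega> \<in> space M" by (simp add: B_def)
        moreover have "j = k \<longleftrightarrow> \<omega> \<in> B k" using j NB[OF j] NB[of \<omega> k] by auto
        ultimately show ?case using NB[OF j] by (auto simp: k)
      qed
    qed auto
    also have "emeasure M (B k) = ennreal (pmf (neg_binomial_pmf r p) k)"
      by (simp add: emeasure_eq_measure pB)
    also have "\<dots> = ennreal (pmf (map_pmf (\<lambda>k. k + r) (neg_binomial_pmf r p)) n)"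
      unfolding k by (subst pmf_map_inj') (auto simp: inj_def)
    finally show "emeasure (distr M (count_space UNIV) (samples_until r X)) {n} =
        emeasure (measure_pmf (map_pmf (\<lambda>k. k + r) (neg_binomial_pmf r p))) {n}"
      by (simp add: emeasure_pmf_single)
  qed auto
qed

text \<open>Bridge from probability to power series: the law of the sample count is a shifted
  negative binomial, and integrability over a discrete law is absolute summability. The success
  probability \<open>p\<close> becomes the series argument \<open>1 - p\<close>.\<close>

lemma expectation_samples_until:
  assumes X: "iid_bernoulli M p X" and p: "0 < p" "p < 1" and r: "r \<ge> 1"
    and f: "quad_growth r (\<lambda>m. f (m + r))"
  shows "integrable M (\<lambda>\<omega>. f (samples_until r X \<omega>) :: real)" (is ?I)
    and "expectation (\<lambda>\<omega>. f (samples_until r X \<omega>)) = nb_mean r (\<lambda>m. f (m + r)) (1 - p)" (is ?E)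
proof -
  let ?P = "neg_binomial_pmf r p" and ?N = "samples_until r X"
  have [measurable]: "X i \<in> measurable M (count_space UNIV)" for i
    using X by (auto simp: iid_bernoulli_def indep_vars_def)
  have N[measurable]: "?N \<in> measurable M (count_space UNIV)"
    by (rule measurable_samples_until) simp
  define h where "h = (\<lambda>m. p ^ r * (nb_coeff r m * f (m + r) * (1 - p) ^ m))"
  have h: "pmf ?P m * f (m + r) = h m" for m
    using p r by (subst pmf_neg_binomial) (auto simp: nb_coeff_def h_def)
  \<comment> \<open>The growth class depends only on absolute values, so the summability lemma also
    yields absolute summability.\<close>
  have "quad_growth r (\<lambda>m. \<bar>f (m + r)\<bar>)"
    using f by (simp add: quad_growth_def)
  then have "summable (\<lambda>m. p ^ r * (nb_coeff r m * \<bar>f (m + r)\<bar> * (1 - p) ^ m))"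
    using p r by (intro summable_mult summable_nb) auto
  moreover have "norm (h m) = p ^ r * (nb_coeff r m * \<bar>f (m + r)\<bar> * (1 - p) ^ m)" for m
    using p by (simp add: h_def abs_mult nb_coeff_nonneg)
  ultimately have "integrable (count_space UNIV) h"
    by (simp add: integrable_count_space_nat_iff)
  then have ih: "integrable (count_space UNIV) (\<lambda>m. pmf ?P m *\<^sub>R f (m + r))"
    by (simp add: h)
  then have iP: "integrable (measure_pmf ?P) (\<lambda>m. f (m + r))"
    unfolding measure_pmf_eq_density by (subst integrable_density) auto
  have "integrable (distr M (count_space UNIV) ?N) f"
    unfolding distr_samples_until[OF X p r] map_pmf_rep_eq
    by (subst integrable_distr_eq) (auto simp: iP)
  then show ?I by (subst (asm) integrable_distr_eq) (auto simp: comp_def)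
  have "expectation (\<lambda>\<omega>. f (?N \<omega>)) = integral\<^sup>L (distr M (count_space UNIV) ?N) f"
    by (subst integral_distr) auto
  also have "\<dots> = measure_pmf.expectation ?P (\<lambda>m. f (m + r))"
    unfolding distr_samples_until[OF X p r] by simp
  also have "\<dots> = (\<integral>m. pmf ?P m *\<^sub>R f (m + r) \<partial>count_space UNIV)"
    unfolding measure_pmf_eq_density by (subst integral_density) auto
  also have "\<dots> = (\<Sum>m. h m)"
    using integral_count_space_nat[OF ih] by (simp add: h)
  also have "\<dots> = nb_mean r (\<lambda>m. f (m + r)) (1 - p)"
    unfolding h_def nb_mean_def using p r f
    by (subst suminf_mult) (auto intro!: summable_nb)
  finally show ?E .
qed

text \<open>Waiting for failures of \<open>Y\<close> is waiting for successes of the negated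
  sequence, so all results on sample counts apply with \<open>1 - p\<close> in place of
  \<open>p\<close>.\<close>

lemma iid_bernoulli_not:
  assumes "iid_bernoulli M p Y" "0 \<le> p" "p \<le> 1"
  shows "iid_bernoulli M (1 - p) (\<lambda>i \<omega>. \<not> Y i \<omega>)"
proof -
  have ind: "indep_vars (\<lambda>_. count_space UNIV) Y UNIV"
    and d: "\<And>i. distr M (count_space UNIV) (Y i) = measure_pmf (bernoulli_pmf p)"
    using assms by (auto simp: iid_bernoulli_def)
  have rv[measurable]: "Y i \<in> measurable M (count_space UNIV)" for i
    using ind by (auto simp: indep_vars_def)
  have eq: "map_pmf Not (bernoulli_pmf p) = bernoulli_pmf (1 - p)"
  proof (rule pmf_eqI)
    fix b
    have "pmf (map_pmf Not (bernoulli_pmf p)) (\<not> \<not> b) = pmf (bernoulli_pmf p) (\<not> b)"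
      by (rule pmf_map_inj') (auto simp: inj_def)
    then show "pmf (map_pmf Not (bernoulli_pmf p)) b = pmf (bernoulli_pmf (1 - p)) b"
      using assms(2,3) by (cases b) auto
  qed
  have "distr M (count_space UNIV) (\<lambda>\<omega>. \<not> Y i \<omega>) = distr (distr M (count_space UNIV) (Y i)) (count_space UNIV) Not" for i
    by (subst distr_distr) (auto simp: comp_def)
  then have "distr M (count_space UNIV) (\<lambda>\<omega>. \<not> Y i \<omega>) = measure_pmf (bernoulli_pmf (1 - p))" for i
    by (simp add: d flip: eq map_pmf_rep_eq)
  moreover have "indep_vars (\<lambda>_. count_space UNIV) (\<lambda>i \<omega>. \<not> Y i \<omega>) UNIV"
    by (rule indep_vars_compose2[OF ind]) auto
  ultimately show ?thesis by (simp add: iid_bernoulli_def)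
qed

text \<open>Each count is a measurable function of one whole Boolean sequence, and independence
  passes through measurable maps.\<close>

lemma indep_samples_until:
  assumes "indep_sequences M X Y"
  shows "indep_var (count_space UNIV) (samples_until r X) (count_space UNIV) (samples_until r (\<lambda>i \<omega>. \<not> Y i \<omega>))"
proof -
  let ?S = "Pi\<^sub>M UNIV (\<lambda>_. count_space UNIV) :: (nat \<Rightarrow> bool) measure"
  have 1: "samples_until r (\<lambda>i w. w i) \<in> measurable ?S (count_space UNIV)"
    by (rule measurable_samples_until) simp
  have 2: "samples_until r (\<lambda>i w. \<not> w i) \<in> measurable ?S (count_space UNIV)"
    by (rule measurable_samples_until) simp
  have "indep_var ?S (\<lambda>\<omega> i. X i \<omega>) ?S (\<lambda>\<omega> i. Y i \<omega>)"
    using assms by (simp add: indep_sequences_def)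
  from indep_var_compose[OF this 1 2] show ?thesis
    by (simp add: comp_def samples_until_def[abs_def])
qed

end

lemma log_odds_deriv:
  assumes "0 < p" "p < 1"
  shows "deriv log_odds p = 1 / (p * (1 - p))"
proof (rule DERIV_imp_deriv)
  have "((\<lambda>p. ln p - ln (1 - p)) has_real_derivative 1 / p + 1 / (1 - p)) (at p)"
    using assms by (auto intro!: derivative_eq_intros)
  moreover have "1 / p + 1 / (1 - p) = 1 / (p * (1 - p))"
    using assms by (simp add: divide_simps)
  \<comment> \<open>The logarithm of the quotient is split only inside (0,1), an open neighbourhood
    of \<open>p\<close>, which suffices for the derivative.\<close>
  moreover have "\<forall>\<^sub>F x in nhds p. log_odds x = ln x - ln (1 - x)"
  proof -
    have "\<forall>\<^sub>F x in nhds p. x \<in> {0<..<1}"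
      using assms by (intro eventually_nhds_in_open) auto
    then show ?thesis
      by eventually_elim (simp add: log_odds_def ln_div)
  qed
  ultimately show "(log_odds has_real_derivative 1 / (p * (1 - p))) (at p)"
    by (simp add: DERIV_cong_ev[OF refl _ refl])
qed

section \<open>The efficiency bounds\<close>

text \<open>The denominator of the middle bound, with a real argument in place of
  \<open>r\<close>.\<close>

definition eff_denom :: "real \<Rightarrow> real \<Rightarrow> real" where
  "eff_denom R p = (R ^ 3 - R ^ 2 / 4 - R / 4) / ((R - 1 + p) * (R - p) * (R - 1/2))
     - R * p * (1 - p) / (R - 1/2) ^ 2 * (1 - 1 / (2 * R - 3))"

text \<open>The left side bounds \<open>r\<close> times the variance of the estimator. With
  \<open>h = R - 1/2\<close> and \<open>w = p * (1 - p)\<close> it equals h/(R - 1) - w/(R - 1), and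
  the two terms are compared separately with those of \<open>eff_denom\<close>.\<close>

lemma eff_denom_gt:
  assumes R: "R \<ge> 2" and p: "0 < p" "p < 1"
  shows "1 + (p\<^sup>2 + (1 - p)\<^sup>2) / (2 * (R - 1)) < eff_denom R p"
proof -
  define w where "w = p * (1 - p)"
  have w: "0 < w" "w \<le> 1/4"
  proof -
    show "0 < w" using p by (simp add: w_def)
    have "0 \<le> (p - 1/2)\<^sup>2" by simp
    then show "w \<le> 1/4" by (simp add: w_def power2_eq_square algebra_simps)
  qed
  define h where "h = R - 1/2"
  have h: "h > 0" using R by (simp add: h_def)
  have fac: "(R - 1 + p) * (R - p) = R * (R - 1) + w"
    by (simp add: w_def algebra_simps)
  \<comment> \<open>Since \<open>w \<le> 1/4\<close>, replacing \<open>R * (R - 1) + w\<close> by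
    \<open>h\<^sup>2\<close> makes the first fraction smallest and free of \<open>p\<close>.\<close>
  have sq: "R * (R - 1) + w \<le> h\<^sup>2" using w by (simp add: h_def power2_eq_square algebra_simps)
  have pos: "R * (R - 1) + w > 0" using R w by (intro add_nonneg_pos) auto

  have "h / (R - 1) < (R ^ 3 - R ^ 2 / 4 - R / 4) / (h\<^sup>2 * h)"
  proof -
    have "R * (R - 1)\<^sup>2 \<ge> 2 * 1"
      using R by (intro mult_mono) (auto simp: power2_eq_square intro: mult_mono[of 1 "R - 1" 1 "R - 1", simplified])
    \<comment> \<open>Cross-multiplied gap of the first comparison; it is positive because
      \<open>R * (R - 1)\<^sup>2 \<ge> 2\<close>.\<close>
    moreover have "(R ^ 3 - R ^ 2 / 4 - R / 4) * (R - 1) - h * (h\<^sup>2 * h) = 3/4 * (R * (R - 1)\<^sup>2) - 1/16"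
      by (simp add: h_def power2_eq_square power3_eq_cube field_simps)
    ultimately have "h * (h\<^sup>2 * h) < (R ^ 3 - R ^ 2 / 4 - R / 4) * (R - 1)" by linarith
    then show ?thesis using h R by (simp add: divide_simps mult_ac)
  qed
  also have "\<dots> \<le> (R ^ 3 - R ^ 2 / 4 - R / 4) / ((R * (R - 1) + w) * h)"
  proof (rule divide_left_mono)
    show "(R * (R - 1) + w) * h \<le> h\<^sup>2 * h" using sq h by simp
    have "R ^ 3 - R ^ 2 / 4 - R / 4 = R * (R * (R - 1/4) - 1/4)"
      by (simp add: power2_eq_square power3_eq_cube algebra_simps)
    moreover have "R * (R - 1/4) \<ge> 2 * 1" using R by (intro mult_mono) auto
    ultimately show "0 \<le> R ^ 3 - R ^ 2 / 4 - R / 4" using R by simp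
    show "0 < h\<^sup>2 * h * ((R * (R - 1) + w) * h)" using h pos by simp
  qed
  finally have 1: "h / (R - 1) < (R ^ 3 - R ^ 2 / 4 - R / 4) / ((R * (R - 1) + w) * h)" .

  have 2: "R * w / h\<^sup>2 * (1 - 1 / (2 * R - 3)) \<le> w / (R - 1)"
  proof -
    \<comment> \<open>Cross-multiplied gap of the second comparison, after removing the common
      factor \<open>w\<close>.\<close>
    have "(2 * R - 3) * h\<^sup>2 - R * (2 * R - 4) * (R - 1) = R * (R - 1/2) - 3/4"
      by (simp add: h_def power2_eq_square algebra_simps)
    moreover have "R * (R - 1/2) \<ge> 2 * 1" using R by (intro mult_mono) auto
    ultimately have "R * (2 * R - 4) * (R - 1) \<le> (2 * R - 3) * h\<^sup>2" by linarith
    then have "w * (R * (2 * R - 4) * (R - 1)) \<le> w * ((2 * R - 3) * h\<^sup>2)"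
      using w by (intro mult_left_mono) auto
    moreover have "1 - 1 / (2 * R - 3) = (2 * R - 4) / (2 * R - 3)" using R by (simp add: divide_simps)
    ultimately show ?thesis using R h by (simp add: divide_simps mult_ac)
  qed
  have "p\<^sup>2 + (1 - p)\<^sup>2 = 1 - 2 * w"
    by (simp add: w_def power2_eq_square algebra_simps)
  then have "1 + (p\<^sup>2 + (1 - p)\<^sup>2) / (2 * (R - 1)) = h / (R - 1) - w / (R - 1)"
    using R by (simp add: h_def divide_simps) (simp add: algebra_simps)
  with 1 2 show ?thesis
    unfolding eff_denom_def fac by (simp add: w_def h_def mult.assoc)
qed

text \<open>Dropping the subtracted term and then p(1 - p) from the first denominator only increases
  the expression and removes \<open>p\<close>; a rational inequality in \<open>R\<close> alone
  remains.\<close>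

lemma eff_denom_lt:
  assumes R: "R \<ge> 2" and p: "0 < p" "p < 1"
  shows "eff_denom R p < R / (R - 5/4) * (((4 * R - 1)\<^sup>2 - 7) / (4 * R - 1)\<^sup>2)"
proof -
  define h where "h = R - 1/2"
  have h: "h > 0" using R by (simp add: h_def)
  have fac: "(R - 1 + p) * (R - p) = R * (R - 1) + p * (1 - p)"
    by (simp add: algebra_simps)
  have w: "0 < p * (1 - p)" using p by simp
  have "R ^ 3 - R ^ 2 / 4 - R / 4 = R * (R * (R - 1/4) - 1/4)"
    by (simp add: power2_eq_square power3_eq_cube algebra_simps)
  moreover have "R * (R - 1/4) \<ge> 2 * 1" using R by (intro mult_mono) auto
  ultimately have num: "0 \<le> R ^ 3 - R ^ 2 / 4 - R / 4" using R by simp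
  \<comment> \<open>At \<open>R = 2\<close> the last factor is 0, so this step is not
    strict.\<close>
  have "0 \<le> R * p * (1 - p) / h ^ 2 * (1 - 1 / (2 * R - 3))"
    using R p by (intro mult_nonneg_nonneg divide_nonneg_nonneg) auto
  then have "eff_denom R p \<le> (R ^ 3 - R ^ 2 / 4 - R / 4) / ((R * (R - 1) + p * (1 - p)) * h)"
    unfolding eff_denom_def fac by (simp add: h_def)
  also have "\<dots> \<le> (R ^ 3 - R ^ 2 / 4 - R / 4) / (R * (R - 1) * h)"
    using num R h w p by (intro divide_left_mono mult_right_mono mult_pos_pos add_pos_pos) auto
  also have "\<dots> = (R\<^sup>2 - R / 4 - 1 / 4) / ((R - 1) * h)"
  proof -
    have "R ^ 3 - R ^ 2 / 4 - R / 4 = R * (R\<^sup>2 - R / 4 - 1 / 4)"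
      by (simp add: power2_eq_square power3_eq_cube algebra_simps)
    then show ?thesis using R by simp
  qed
  also have "\<dots> < R * ((4 * R - 1)\<^sup>2 - 7) / ((R - 5/4) * (4 * R - 1)\<^sup>2)"
  proof -
    \<comment> \<open>Cross-multiplication reduces the claim to the sign of this quadratic, positive
      for \<open>R \<ge> 2\<close>; the strictness of the lemma comes from here.\<close>
    have "R * ((4 * R - 1)\<^sup>2 - 7) * ((R - 1) * h) - (R\<^sup>2 - R / 4 - 1 / 4) * ((R - 5/4) * (4 * R - 1)\<^sup>2)
        = 2 * R\<^sup>2 - 9/16 * R - 5/16"
      by (simp add: h_def power2_eq_square field_simps)
    moreover have "R\<^sup>2 \<ge> 2 * R" using R by (simp add: power2_eq_square)
    ultimately have "(R\<^sup>2 - R / 4 - 1 / 4) * ((R - 5/4) * (4 * R - 1)\<^sup>2) < R * ((4 * R - 1)\<^sup>2 - 7) * ((R - 1) * h)"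
      using R by linarith
    moreover have "0 < (R - 5/4) * (4 * R - 1)\<^sup>2" "0 < (R - 1) * h" using R h by auto
    ultimately show ?thesis by (simp add: divide_less_eq less_divide_eq mult_ac pos_divide_less_eq)
  qed
  finally show ?thesis by simp
qed

section \<open>Variance and cost of the estimator, and the chain of bounds\<close>

theorem mainTheorem4:
  fixes M :: "'a measure" and X Y :: "nat \<Rightarrow> 'a \<Rightarrow> bool"
    and p :: real and r :: nat
    and N1 N2 N :: "'a \<Rightarrow> nat" and phi_hat :: "'a \<Rightarrow> real"
  assumes "prob_space M"
    and "r \<ge> 2" and "0 < p" and "p < 1"
    and "iid_bernoulli M p X" and "iid_bernoulli M p Y"
    and "indep_sequences M X Y"
    and N1: "N1 = samples_until r X"
    and N2: "N2 = samples_until r (\<lambda>i \<omega>. \<not> Y i \<omega>)"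
    and phi_hat: "phi_hat = (\<lambda>\<omega>. - harm (N1 \<omega> - 1) + harm (N2 \<omega> - 1))"
    and N: "N = (\<lambda>\<omega>. N1 \<omega> + N2 \<omega>)"
  shows "efficiency M log_odds p phi_hat N =
           1 / (p * (1 - p) * prob_space.variance M phi_hat
                * prob_space.expectation M (\<lambda>\<omega>. real (N \<omega>)))
       \<and> efficiency M log_odds p phi_hat N >
           1 / ((real r ^ 3 - real r ^ 2 / 4 - real r / 4)
                  / ((real r - 1 + p) * (real r - p) * (real r - 1/2))
                - real r * p * (1 - p) / (real r - 1/2) ^ 2 * (1 - 1 / (2 * real r - 3)))
       \<and> 1 / ((real r ^ 3 - real r ^ 2 / 4 - real r / 4)
                  / ((real r - 1 + p) * (real r - p) * (real r - 1/2))
                - real r * p * (1 - p) / (real r - 1/2) ^ 2 * (1 - 1 / (2 * real r - 3)))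
           > (real r - 5/4) / real r * ((4 * real r - 1) ^ 2 / ((4 * real r - 1) ^ 2 - 7))
       \<and> (real r - 5/4) / real r * ((4 * real r - 1) ^ 2 / ((4 * real r - 1) ^ 2 - 7))
           > (real r - 5/4) / real r"
proof -
  interpret prob_space M by fact
  note r = \<open>r \<ge> 2\<close> and p = \<open>0 < p\<close> \<open>p < 1\<close>
  have r1: "r \<ge> 1" and q: "0 < 1 - p" "1 - p < 1" using r p by auto
  define R where "R = real r"
  have R: "R \<ge> 2" using r by (simp add: R_def)
  have X: "iid_bernoulli M p X" by fact
  have Y: "iid_bernoulli M (1 - p) (\<lambda>i \<omega>. \<not> Y i \<omega>)"
    using iid_bernoulli_not[of p Y] \<open>iid_bernoulli M p Y\<close> p by simp
  define A B where "A = (\<lambda>\<omega>. harm (N1 \<omega> - 1) :: real)" and "B = (\<lambda>\<omega>. harm (N2 \<omega> - 1) :: real)"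
  have gN: "quad_growth r (\<lambda>m. real (m + r))"
    by (rule quad_growth_bounded_by_index) (use r1 in auto)

  note EX = expectation_samples_until[OF X p r1, folded N1]
  \<comment> \<open>The success probability is now \<open>1 - p\<close>, so the means for
    \<open>N2\<close> are evaluated at \<open>1 - (1 - p) = p\<close>.\<close>
  note EY = expectation_samples_until[OF Y q r1, folded N2]
  note hX = EX[of "\<lambda>n. harm (n - 1)", OF quad_growth_harm[OF r], folded A_def]
  note hY = EY[of "\<lambda>n. harm (n - 1)", OF quad_growth_harm[OF r], folded B_def]
  have A2: "integrable M (\<lambda>\<omega>. (A \<omega>)\<^sup>2)"
    "expectation (\<lambda>\<omega>. (A \<omega>)\<^sup>2) = nb_mean r (\<lambda>m. (harm (m + r - 1))\<^sup>2) (1 - p)"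
    using EX[of "\<lambda>n. (harm (n - 1))\<^sup>2", OF quad_growth_harm_sq[OF r]] by (simp_all add: A_def)
  have B2: "integrable M (\<lambda>\<omega>. (B \<omega>)\<^sup>2)"
    "expectation (\<lambda>\<omega>. (B \<omega>)\<^sup>2) = nb_mean r (\<lambda>m. (harm (m + r - 1))\<^sup>2) p"
    using EY[of "\<lambda>n. (harm (n - 1))\<^sup>2", OF quad_growth_harm_sq[OF r]] by (simp_all add: B_def)
  have "indep_var (count_space UNIV) N1 (count_space UNIV) N2"
    unfolding N1 N2 by (rule indep_samples_until) fact
  from indep_var_compose[OF this, of "\<lambda>n. harm (n - 1)" borel "\<lambda>n. harm (n - 1)" borel]
  have ind: "indep_var borel A borel B"
    by (simp add: comp_def A_def B_def)
  note AB = indep_var_integrable[OF ind hX(1) hY(1)] indep_var_lebesgue_integral[OF ind hX(1) hY(1)]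

  have phi: "phi_hat = (\<lambda>\<omega>. B \<omega> - A \<omega>)" by (simp add: phi_hat A_def B_def)
  have sq: "(phi_hat \<omega>)\<^sup>2 = (A \<omega>)\<^sup>2 + (B \<omega>)\<^sup>2 - 2 * (A \<omega> * B \<omega>)" for \<omega>
    by (simp add: phi power2_eq_square algebra_simps)
  have E1: "expectation phi_hat = expectation B - expectation A"
    unfolding phi using hX(1) hY(1) by simp
  have E2: "expectation (\<lambda>\<omega>. (phi_hat \<omega>)\<^sup>2) = expectation (\<lambda>\<omega>. (A \<omega>)\<^sup>2) + expectation (\<lambda>\<omega>. (B \<omega>)\<^sup>2)
      - 2 * (expectation A * expectation B)"
    unfolding sq using A2(1) B2(1) AB by simp
  have E3: "variance phi_hat = expectation (\<lambda>\<omega>. (phi_hat \<omega>)\<^sup>2) - (expectation phi_hat)\<^sup>2"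
  proof (rule variance_eq)
    show "integrable M phi_hat" unfolding phi using hX(1) hY(1) by simp
    show "integrable M (\<lambda>\<omega>. (phi_hat \<omega>)\<^sup>2)" unfolding sq using A2(1) B2(1) AB(1) by simp
  qed
  \<comment> \<open>Independence makes the mean of \<open>A * B\<close> a product, so the cross
    terms cancel and the variances add.\<close>
  have "variance phi_hat = (expectation (\<lambda>\<omega>. (A \<omega>)\<^sup>2) - (expectation A)\<^sup>2)
      + (expectation (\<lambda>\<omega>. (B \<omega>)\<^sup>2) - (expectation B)\<^sup>2)"
    by (simp only: E3) (simp add: E1 E2 power2_diff)
  then have var: "variance phi_hat = nb_harm_var r (1 - p) + nb_harm_var r p"
    using A2(2) B2(2) hX(2) hY(2) by (simp add: nb_harm_var_def)

  have "expectation (\<lambda>\<omega>. real (N \<omega>)) = expectation (\<lambda>\<omega>. real (N1 \<omega>)) + expectation (\<lambda>\<omega>. real (N2 \<omega>))"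
    unfolding N using EX(1)[OF gN] EY(1)[OF gN] by simp
  also have "\<dots> = R / p + R / (1 - p)"
    using EX(2)[OF gN] EY(2)[OF gN] nb_mean_count[OF r1, of "1 - p"] nb_mean_count[OF r1, of p] p
    by (simp add: R_def)
  also have "\<dots> = R / (p * (1 - p))" using p by (simp add: divide_simps) (simp add: algebra_simps)
  finally have EN: "expectation (\<lambda>\<omega>. real (N \<omega>)) = R / (p * (1 - p))" .

  define V where "V = variance phi_hat"
  define D where "D = eff_denom R p"
  have V0: "0 < V"
    using nb_harm_var_pos[OF r q] nb_harm_var_pos[OF r p] by (simp add: V_def var)
  have "R * V \<le> R * ((1 - p) / R + (1 - p)\<^sup>2 / (2 * R * (R - 1)) + (p / R + p\<^sup>2 / (2 * R * (R - 1))))"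
    using nb_harm_var_le[OF r q] nb_harm_var_le[OF r p] R
    by (intro mult_left_mono) (auto simp: V_def var R_def)
  also have "\<dots> = 1 + (p\<^sup>2 + (1 - p)\<^sup>2) / (2 * (R - 1))"
    using R by (simp add: distrib_left add_divide_distrib)
  also have "\<dots> < D" unfolding D_def by (rule eff_denom_gt[OF R p])
  finally have VD: "R * V < D" .
  have RV: "0 < R * V" using R V0 by simp

  \<comment> \<open>The numerator is 1/(p(1 - p)), the same factor that appears in E[N], and it
    cancels.\<close>
  have eff: "efficiency M log_odds p phi_hat N = 1 / (R * V)"
    unfolding efficiency_def log_odds_deriv[OF p] EN V_def[symmetric] using p
    by (simp add: power2_eq_square)
  have "efficiency M log_odds p phi_hat N =
      1 / (p * (1 - p) * variance phi_hat * expectation (\<lambda>\<omega>. real (N \<omega>)))"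
    unfolding eff EN V_def[symmetric] using p by simp
  moreover have "efficiency M log_odds p phi_hat N > 1 / D"
    unfolding eff using RV VD by (intro divide_strict_left_mono) auto
  moreover define S where "S = (4 * R - 1)\<^sup>2"
  have S: "S > 7"
  proof -
    have "7\<^sup>2 \<le> S" unfolding S_def using R by (intro power_mono) auto
    then show ?thesis by simp
  qed
  moreover have "1 / D > (R - 5/4) / R * (S / (S - 7))"
  proof -
    have "D < R / (R - 5/4) * ((S - 7) / S)"
      unfolding D_def S_def by (rule eff_denom_lt[OF R p])
    \<comment> \<open>Positivity of \<open>D\<close> comes from the strict variance bound, not from
      its formula; it justifies inverting the inequality.\<close>
    moreover have "0 < D" using RV VD by linarith
    ultimately have "1 / (R / (R - 5/4) * ((S - 7) / S)) < 1 / D"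
      by (intro frac_less2) (assumption | simp)+
    then show ?thesis by simp
  qed
  moreover have "(R - 5/4) / R * (S / (S - 7)) > (R - 5/4) / R"
  proof -
    have "1 < S / (S - 7)" using S by simp
    then show ?thesis using mult_strict_left_mono[of 1 "S / (S - 7)" "(R - 5/4) / R"] R by simp
  qed
  ultimately show ?thesis by (simp add: D_def S_def eff_denom_def R_def)
qed

end
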